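(* Let $\Omega$ be a Polish space and $(T(t))_{t\ge0}\subset\mathscr{L}(\mathscr{M}(\Omega),\sigma)$ a stochastically continuous Markovian semigroup, and let $\mu\in\mathscr{M}(\Omega)$ be an invariant probability measure ($T(t)\mu=\mu$ for all $t\ge0$). If the semigroup is $t_0$-regular for some $t_0>0$, then \[\lim_{t\to\infty}T(t)\nu=\nu(\Omega)\,\mu\] in the total variation norm of $\mathscr{M}(\Omega)$ for every $\nu\in\mathscr{M}(\Omega)$. Moreover, $\mu$ is the unique invariant probability measure, and $\mu$ is equivalent to $k_t(x,\cdot)$ for all $t\ge t_0$ and $x\in\Omega$.
   Context: $\mathscr{M}(\Omega)$: finite signed Borel measures with total variation norm. A weakly continuous operator is one of the form $(T\mu)(A)=\int k(x,A)\,d\mu(x)$ with $k$ a bounded transition kernel (map $\Omega\times\mathscr{B}(\Omega)\to\mathbb{R}$, signed measure in the second variable, Borel measurable in the first, $\sup_x\lvert k\rvert(x,\Omega)<\infty$); $\mathscr{L}(\mathscr{M}(\Omega),\sigma)$ is the space of such operators. A semigroup $(T(t))_{t\ge0}$ satisfies $T(0)=I$, $T(t+s)=T(t)T(s)$; $k_t$ denotes the kernel of $T(t)$. It is Markovian if each $k_t(x,\cdot)$ is a probability measure; stochastically continuous if $\lim_{t\to0}\int_\Omega f(y)\,k_t(x,dy)=f(x)$ for all bounded continuous $f$ and all $x\in\Omega$; $t_0$-regular ($t_0>0$) if $k_{t_0}(x,\cdot)$ and $k_{t_0}(y,\cdot)$ are equivalent for all $x,y\in\Omega$. *)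

theory Defs
  imports "HOL-Analysis.Analysis"
begin

text \<open>Finite signed Borel measures on a topological space, represented as real-valued
  set functions that are countably additive on the Borel sets (values on non-Borel sets
  are irrelevant and never used).\<close>
definition signed_measure :: "('a::topological_space set \<Rightarrow> real) \<Rightarrow> bool" where
  "signed_measure \<mu> \<longleftrightarrow> \<mu> {} = 0 \<and>
     (\<forall>A::nat \<Rightarrow> 'a set. range A \<subseteq> sets borel \<longrightarrow> disjoint_family A \<longrightarrow>
        (\<lambda>n. \<mu> (A n)) sums \<mu> (\<Union>n. A n))"

definition tv_norm :: "('a::topological_space set \<Rightarrow> real) \<Rightarrow> real" where
  "tv_norm \<mu> = Sup {(\<Sum>i<n. \<bar>\<mu> (A i)\<bar>) | (n::nat) A.
       (\<forall>i<n. A i \<in> sets borel) \<and> disjoint_family_on A {..<n}}"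

definition pos_var :: "('a::topological_space set \<Rightarrow> real) \<Rightarrow> 'a set \<Rightarrow> real" where
  "pos_var \<mu> A = Sup {\<mu> B | B. B \<in> sets borel \<and> B \<subseteq> A}"

definition pos_var_measure :: "('a::topological_space set \<Rightarrow> real) \<Rightarrow> 'a measure" where
  "pos_var_measure \<mu> = measure_of UNIV (sets borel) (\<lambda>A. ennreal (pos_var \<mu> A))"

text \<open>Integral of f with respect to a signed measure, via the Jordan decomposition
  mu = mu^+ - mu^-.\<close>
definition signed_integral :: "('a::topological_space set \<Rightarrow> real) \<Rightarrow> ('a \<Rightarrow> real) \<Rightarrow> real" where
  "signed_integral \<mu> f =
     (\<integral>x. f x \<partial>pos_var_measure \<mu>) - (\<integral>x. f x \<partial>pos_var_measure (\<lambda>A. - \<mu> A))"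

definition bounded_kernel :: "('a::topological_space \<Rightarrow> 'a set \<Rightarrow> real) \<Rightarrow> bool" where
  "bounded_kernel k \<longleftrightarrow> (\<forall>x. signed_measure (k x)) \<and>
     (\<forall>A \<in> sets borel. (\<lambda>x. k x A) \<in> borel_measurable borel) \<and>
     (\<exists>C. \<forall>x. tv_norm (k x) \<le> C)"

definition kernel_op :: "('a::topological_space \<Rightarrow> 'a set \<Rightarrow> real) \<Rightarrow>
    ('a set \<Rightarrow> real) \<Rightarrow> 'a set \<Rightarrow> real" where
  "kernel_op k \<mu> A = signed_integral \<mu> (\<lambda>x. k x A)"

definition prob_signed_measure :: "('a::topological_space set \<Rightarrow> real) \<Rightarrow> bool" where
  "prob_signed_measure \<mu> \<longleftrightarrow> signed_measure \<mu> \<and> (\<forall>A \<in> sets borel. \<mu> A \<ge> 0) \<and> \<mu> UNIV = 1"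

definition equivalent_measures :: "('a::topological_space set \<Rightarrow> real) \<Rightarrow> ('a set \<Rightarrow> real) \<Rightarrow> bool" where
  "equivalent_measures \<mu> \<nu> \<longleftrightarrow> (\<forall>A \<in> sets borel. \<mu> A = 0 \<longleftrightarrow> \<nu> A = 0)"

text \<open>Semigroup (T(t))_{t\<ge>0} in L(M(Omega),sigma), given by its kernels k t.\<close>
definition kernel_semigroup :: "(real \<Rightarrow> 'a::topological_space \<Rightarrow> 'a set \<Rightarrow> real) \<Rightarrow> bool" where
  "kernel_semigroup k \<longleftrightarrow>
     (\<forall>t\<ge>0. bounded_kernel (k t)) \<and>
     (\<forall>\<nu>. signed_measure \<nu> \<longrightarrow> (\<forall>A \<in> sets borel. kernel_op (k 0) \<nu> A = \<nu> A)) \<and>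
     (\<forall>t\<ge>0. \<forall>s\<ge>0. \<forall>\<nu>. signed_measure \<nu> \<longrightarrow> (\<forall>A \<in> sets borel.
         kernel_op (k (t + s)) \<nu> A = kernel_op (k t) (kernel_op (k s) \<nu>) A))"

definition markovian :: "(real \<Rightarrow> 'a::topological_space \<Rightarrow> 'a set \<Rightarrow> real) \<Rightarrow> bool" where
  "markovian k \<longleftrightarrow> (\<forall>t\<ge>0. \<forall>x. prob_signed_measure (k t x))"

definition stoch_continuous :: "(real \<Rightarrow> 'a::topological_space \<Rightarrow> 'a set \<Rightarrow> real) \<Rightarrow> bool" where
  "stoch_continuous k \<longleftrightarrow> (\<forall>f::'a \<Rightarrow> real. continuous_on UNIV f \<longrightarrow> bounded (range f) \<longrightarrow>
     (\<forall>x. ((\<lambda>t. signed_integral (k t x) f) \<longlongrightarrow> f x) (at_right 0)))"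

definition regular_at :: "(real \<Rightarrow> 'a::topological_space \<Rightarrow> 'a set \<Rightarrow> real) \<Rightarrow> real \<Rightarrow> bool" where
  "regular_at k t0 \<longleftrightarrow> (\<forall>x y. equivalent_measures (k t0 x) (k t0 y))"

definition invariant_measure :: "(real \<Rightarrow> 'a::topological_space \<Rightarrow> 'a set \<Rightarrow> real) \<Rightarrow> ('a set \<Rightarrow> real) \<Rightarrow> bool" where
  "invariant_measure k \<mu> \<longleftrightarrow> (\<forall>t\<ge>0. \<forall>A \<in> sets borel. kernel_op (k t) \<mu> A = \<mu> A)"

end

theory Submission
  imports Defs
begin

text \<open>
  Let \<open>P = T(t\<^sub>0)\<close> and let \<open>D(\<nu>) = \<nu>\<^sup>+(\<Omega>)\<close>. Since \<open>D\<close> does not increase along the semigroup, it suffices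
  to show \<open>D(P\<^sup>n \<nu>) \<rightarrow> 0\<close> when \<open>\<nu>(\<Omega>) = 0\<close>. Invariance and regularity give \<open>\<mu> \<sim> k\<^sub>t\<^sub>0(x,\<cdot>)\<close>, so
  \<open>P\<nu> \<lless> \<mu>\<close> and we may assume \<open>\<nu> \<lless> \<mu>\<close>. Then for every \<open>\<epsilon> > 0\<close> there is a \<open>C\<close> with
  \<open>\<bar>\<nu>(A)\<bar> \<le> C \<mu>(A) + \<epsilon>\<close> for all \<open>A\<close>, and all \<open>P\<^sup>n \<nu>\<close> inherit this bound because \<open>P\<mu> = \<mu>\<close>.

  If \<open>D(P\<nu>)\<close> is close to \<open>D(\<nu>) \<ge> m > 0\<close>, some set \<open>A\<close> has \<open>k\<^sub>t\<^sub>0(x,A)\<close> close to 1 for most \<open>x\<close> under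
  \<open>\<nu>\<^sup>+\<close> and close to 0 for most \<open>x\<close> under \<open>\<nu>\<^sup>-\<close>, hence both on sets whose \<open>\<mu>\<close>-measure is bounded below
  in terms of \<open>m\<close> and \<open>C\<close>. A Borel-Cantelli argument shows that regularity forbids this below some
  threshold. So \<open>D\<close> drops by a fixed amount at each step as long as it is at least \<open>m\<close>.
\<close>

section \<open>Signed measures and their positive variation\<close>

lemma signed_measure_empty: "signed_measure \<nu> \<Longrightarrow> \<nu> {} = 0"
  by (simp add: signed_measure_def)

lemma signed_measure_sums:
  "signed_measure \<nu> \<Longrightarrow> (\<And>n::nat. A n \<in> sets borel) \<Longrightarrow> disjoint_family A \<Longrightarrow>
    (\<lambda>n. \<nu> (A n)) sums \<nu> (\<Union>n. A n)"
  unfolding signed_measure_def by blast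

lemma signed_measure_Un:
  assumes "signed_measure \<nu>" "A \<in> sets borel" "B \<in> sets borel" "A \<inter> B = {}"
  shows "\<nu> (A \<union> B) = \<nu> A + \<nu> B"
proof -
  have "(\<lambda>n. \<nu> (binaryset A B n)) sums \<nu> (\<Union>n. binaryset A B n)"
  proof (rule signed_measure_sums[OF assms(1)])
    show "binaryset A B n \<in> sets borel" for n
      using assms by (simp add: binaryset_def)
    show "disjoint_family (binaryset A B)"
      using assms(4) by (auto simp: disjoint_family_on_def binaryset_def)
  qed
  moreover have "(\<lambda>n. \<nu> (binaryset A B n)) sums (\<nu> A + \<nu> B)"
    by (rule binaryset_sums) (rule signed_measure_empty[OF assms(1)])
  ultimately show ?thesis
    by (simp add: UN_binaryset_eq sums_unique2)
qed

lemma signed_measure_Diff: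
  assumes "signed_measure \<nu>" "A \<in> sets borel" "B \<in> sets borel" "B \<subseteq> A"
  shows "\<nu> (A - B) = \<nu> A - \<nu> B"
proof -
  have "\<nu> ((A - B) \<union> B) = \<nu> (A - B) + \<nu> B"
    using assms by (intro signed_measure_Un) auto
  moreover have "(A - B) \<union> B = A" using assms(4) by auto
  ultimately show ?thesis by simp
qed

lemma signed_measure_lincomb:
  assumes "signed_measure \<nu>" "signed_measure \<rho>"
  shows "signed_measure (\<lambda>A. a * \<nu> A + b * \<rho> A)"
  using assms unfolding signed_measure_def by (auto intro!: sums_add sums_mult)

lemma signed_measure_minus: "signed_measure \<nu> \<Longrightarrow> signed_measure (\<lambda>A. - \<nu> A)"
  unfolding signed_measure_def by (auto intro!: sums_minus)

definition unbounded_on :: "('a::topological_space set \<Rightarrow> real) \<Rightarrow> 'a set \<Rightarrow> bool" where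
  "unbounded_on \<nu> A \<longleftrightarrow> A \<in> sets borel \<and> (\<forall>K. \<exists>B\<in>sets borel. B \<subseteq> A \<and> K < \<bar>\<nu> B\<bar>)"

lemma unbounded_on_subset_or_Diff:
  assumes \<nu>: "signed_measure \<nu>" and A: "unbounded_on \<nu> A" and B: "B \<in> sets borel" "B \<subseteq> A"
  shows "unbounded_on \<nu> B \<or> unbounded_on \<nu> (A - B)"
proof (rule ccontr)
  assume "\<not> ?thesis"
  moreover have "A - B \<in> sets borel" using A B by (simp add: unbounded_on_def sets.Diff)
  ultimately obtain K L where
    K: "\<And>D. D \<in> sets borel \<Longrightarrow> D \<subseteq> B \<Longrightarrow> \<bar>\<nu> D\<bar> \<le> K" and
    L: "\<And>D. D \<in> sets borel \<Longrightarrow> D \<subseteq> A - B \<Longrightarrow> \<bar>\<nu> D\<bar> \<le> L"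
    using B unfolding unbounded_on_def not_less by (metis linorder_not_less)
  obtain D where D: "D \<in> sets borel" "D \<subseteq> A" "K + L < \<bar>\<nu> D\<bar>"
    using A unfolding unbounded_on_def by blast
  have "\<nu> ((D \<inter> B) \<union> (D - B)) = \<nu> (D \<inter> B) + \<nu> (D - B)"
    using \<nu> D B by (intro signed_measure_Un) auto
  moreover have "(D \<inter> B) \<union> (D - B) = D" by auto
  moreover have "\<bar>\<nu> (D \<inter> B)\<bar> \<le> K" "\<bar>\<nu> (D - B)\<bar> \<le> L"
    using D B by (auto intro!: K L)
  ultimately show False using D(3) by simp
qed

lemma unbounded_on_split:
  assumes \<nu>: "signed_measure \<nu>" and A: "unbounded_on \<nu> A"
  obtains A' where "unbounded_on \<nu> A'" "A' \<subseteq> A" "1 \<le> \<bar>\<nu> (A - A')\<bar>"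
proof -
  obtain B where B: "B \<in> sets borel" "B \<subseteq> A" "1 + \<bar>\<nu> A\<bar> < \<bar>\<nu> B\<bar>"
    using A unfolding unbounded_on_def by blast
  have "\<nu> (A - B) = \<nu> A - \<nu> B"
    using A B \<nu> by (intro signed_measure_Diff) (auto simp: unbounded_on_def)
  then have "1 \<le> \<bar>\<nu> (A - B)\<bar>" "1 \<le> \<bar>\<nu> (A - (A - B))\<bar>"
    using B by (auto simp: double_diff)
  with unbounded_on_subset_or_Diff[OF \<nu> A B(1,2)] show ?thesis
    using B(2) by (elim disjE) (auto intro: that)
qed

lemma signed_measure_bounded:
  assumes \<nu>: "signed_measure \<nu>"
  obtains K where "\<And>B. B \<in> sets borel \<Longrightarrow> \<bar>\<nu> B\<bar> \<le> K"
proof -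
  have "\<not> unbounded_on \<nu> UNIV"
  proof
    assume "unbounded_on \<nu> UNIV"
    then obtain F where F: "\<And>n::nat. unbounded_on \<nu> (F n)" "\<And>n. F (Suc n) \<subseteq> F n"
      and mass: "\<And>n. 1 \<le> \<bar>\<nu> (F n - F (Suc n))\<bar>"
      using dependent_nat_choice[of "\<lambda>_. unbounded_on \<nu>" "\<lambda>_ A A'. A' \<subseteq> A \<and> 1 \<le> \<bar>\<nu> (A - A')\<bar>"]
        unbounded_on_split[OF \<nu>] by metis
    have "disjoint_family (\<lambda>n. - F (Suc n) - - F n)"
      using F(2) by (intro disjoint_family_Suc) auto
    then have "disjoint_family (\<lambda>n. F n - F (Suc n))"
      by (simp add: disjoint_family_on_def Diff_eq Int_commute)
    then have "(\<lambda>n. \<nu> (F n - F (Suc n))) sums \<nu> (\<Union>n. F n - F (Suc n))"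
      using F(1) by (intro signed_measure_sums[OF \<nu>]) (auto simp: unbounded_on_def)
    then have "(\<lambda>n. \<nu> (F n - F (Suc n))) \<longlonglongrightarrow> 0"
      by (intro summable_LIMSEQ_zero) (rule sums_summable)
    then show False
      using LIMSEQ_le_const[OF tendsto_rabs_zero, of _ 1] mass by fastforce
  qed
  then show ?thesis using that by (auto simp: unbounded_on_def not_less)
qed

lemma pos_var_upper:
  assumes "signed_measure \<nu>" "B \<in> sets borel" "B \<subseteq> A"
  shows "\<nu> B \<le> pos_var \<nu> A"
proof -
  obtain K where K: "\<And>B. B \<in> sets borel \<Longrightarrow> \<bar>\<nu> B\<bar> \<le> K"
    using signed_measure_bounded[OF assms(1)] by blast
  have "bdd_above {\<nu> B | B. B \<in> sets borel \<and> B \<subseteq> A}"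
    using K by (intro bdd_aboveI[of _ K]) (auto intro: order_trans[OF abs_ge_self])
  then show ?thesis
    unfolding pos_var_def using assms by (intro cSup_upper) auto
qed

lemma pos_var_least:
  assumes "\<And>B. B \<in> sets borel \<Longrightarrow> B \<subseteq> A \<Longrightarrow> \<nu> B \<le> c"
  shows "pos_var \<nu> A \<le> c"
  unfolding pos_var_def using assms by (intro cSup_least) auto

lemma pos_var_nonneg: "signed_measure \<nu> \<Longrightarrow> 0 \<le> pos_var \<nu> A"
  using pos_var_upper[of \<nu> "{}" A] by (simp add: signed_measure_empty)

lemma pos_var_mono: "signed_measure \<nu> \<Longrightarrow> A \<subseteq> B \<Longrightarrow> pos_var \<nu> A \<le> pos_var \<nu> B"
  by (rule pos_var_least) (auto intro: pos_var_upper)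

lemma pos_var_empty: "signed_measure \<nu> \<Longrightarrow> pos_var \<nu> {} = 0"
  by (intro antisym pos_var_nonneg pos_var_least) (auto simp: signed_measure_empty)

lemma pos_var_cong: "(\<And>A. A \<in> sets borel \<Longrightarrow> \<nu> A = \<rho> A) \<Longrightarrow> pos_var \<nu> = pos_var \<rho>"
  unfolding pos_var_def by (intro ext arg_cong[where f = Sup] Collect_cong) metis

abbreviation neg_var :: "('a::topological_space set \<Rightarrow> real) \<Rightarrow> 'a set \<Rightarrow> real" where
  "neg_var \<nu> \<equiv> pos_var (\<lambda>A. - \<nu> A)"

lemma pos_var_le_neg_var_plus:
  assumes \<nu>: "signed_measure \<nu>" and A: "A \<in> sets borel"
  shows "pos_var \<nu> A \<le> neg_var \<nu> A + \<nu> A"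
proof (rule pos_var_least)
  fix B assume B: "B \<in> sets borel" "B \<subseteq> A"
  have "- \<nu> (A - B) \<le> neg_var \<nu> A"
    using A B pos_var_upper[OF signed_measure_minus[OF \<nu>], of "A - B" A] by auto
  then show "\<nu> B \<le> neg_var \<nu> A + \<nu> A" using signed_measure_Diff[OF \<nu> A B] by simp
qed

lemma neg_var_eq:
  assumes \<nu>: "signed_measure \<nu>" and A: "A \<in> sets borel"
  shows "neg_var \<nu> A = pos_var \<nu> A - \<nu> A"
  using pos_var_le_neg_var_plus[OF \<nu> A] pos_var_le_neg_var_plus[OF signed_measure_minus[OF \<nu>] A]
  by simp

lemma abs_le_pos_var_plus_neg_var:
  assumes \<nu>: "signed_measure \<nu>" and A: "A \<in> sets borel"
  shows "\<bar>\<nu> A\<bar> \<le> pos_var \<nu> A + neg_var \<nu> A"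
  using neg_var_eq[OF \<nu> A] pos_var_nonneg[OF \<nu>, of A]
    pos_var_nonneg[OF signed_measure_minus[OF \<nu>], of A] by linarith

definition nonneg_measure :: "('a::topological_space set \<Rightarrow> real) \<Rightarrow> bool" where
  "nonneg_measure \<mu> \<longleftrightarrow> signed_measure \<mu> \<and> (\<forall>A\<in>sets borel. 0 \<le> \<mu> A)"

lemma nonneg_measureD:
  assumes "nonneg_measure \<mu>"
  shows "signed_measure \<mu>" "A \<in> sets borel \<Longrightarrow> 0 \<le> \<mu> A"
  using assms by (auto simp: nonneg_measure_def)

lemma nonneg_measure_mono:
  assumes "nonneg_measure \<mu>" "A \<in> sets borel" "B \<in> sets borel" "A \<subseteq> B"
  shows "\<mu> A \<le> \<mu> B"
proof -
  have "0 \<le> \<mu> (B - A)" using assms by (intro nonneg_measureD(2)) auto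
  also have "\<dots> = \<mu> B - \<mu> A" using assms by (intro signed_measure_Diff nonneg_measureD(1))
  finally show ?thesis by simp
qed

lemma pos_var_of_nonneg:
  assumes "nonneg_measure \<mu>" "A \<in> sets borel"
  shows "pos_var \<mu> A = \<mu> A"
proof (rule antisym)
  show "pos_var \<mu> A \<le> \<mu> A"
    using assms by (intro pos_var_least) (rule nonneg_measure_mono)
  show "\<mu> A \<le> pos_var \<mu> A"
    using assms by (intro pos_var_upper nonneg_measureD(1)) auto
qed

lemma pos_var_Un_ge:
  assumes \<nu>: "signed_measure \<nu>" and "A \<inter> B = {}"
  shows "pos_var \<nu> A + pos_var \<nu> B \<le> pos_var \<nu> (A \<union> B)"
proof -
  have "pos_var \<nu> A \<le> pos_var \<nu> (A \<union> B) - pos_var \<nu> B"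
  proof (rule pos_var_least)
    fix D assume D: "D \<in> sets borel" "D \<subseteq> A"
    have "pos_var \<nu> B \<le> pos_var \<nu> (A \<union> B) - \<nu> D"
    proof (rule pos_var_least)
      fix E assume E: "E \<in> sets borel" "E \<subseteq> B"
      have "\<nu> D + \<nu> E = \<nu> (D \<union> E)"
        using D E assms by (intro signed_measure_Un[symmetric]) auto
      also have "\<dots> \<le> pos_var \<nu> (A \<union> B)" using D E by (intro pos_var_upper[OF \<nu>]) auto
      finally show "\<nu> E \<le> pos_var \<nu> (A \<union> B) - \<nu> D" by simp
    qed
    then show "\<nu> D \<le> pos_var \<nu> (A \<union> B) - pos_var \<nu> B" by simp
  qed
  then show ?thesis by simp
qed

lemma sum_pos_var_le:
  fixes A :: "nat \<Rightarrow> 'a::topological_space set"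
  assumes \<nu>: "signed_measure \<nu>" and "disjoint_family_on A {..<n}"
  shows "(\<Sum>i<n. pos_var \<nu> (A i)) \<le> pos_var \<nu> (\<Union>i<n. A i)"
  using assms(2)
proof (induction n)
  case 0
  then show ?case by (simp add: pos_var_empty[OF \<nu>])
next
  case (Suc n)
  have "disjoint_family_on A {..<n}"
    using Suc.prems by (rule disjoint_family_on_mono[rotated]) auto
  then have "(\<Sum>i<Suc n. pos_var \<nu> (A i)) \<le> pos_var \<nu> (\<Union>i<n. A i) + pos_var \<nu> (A n)"
    using Suc.IH by simp
  also have "\<dots> \<le> pos_var \<nu> ((\<Union>i<n. A i) \<union> A n)"
  proof (rule pos_var_Un_ge[OF \<nu>])
    have "A i \<inter> A n = {}" if "i < n" for i
      using disjoint_family_onD[OF Suc.prems, of i n] that by simp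
    then show "(\<Union>i<n. A i) \<inter> A n = {}" by blast
  qed
  also have "(\<Union>i<n. A i) \<union> A n = (\<Union>i<Suc n. A i)" by (auto simp: lessThan_Suc)
  finally show ?case .
qed

lemma pos_var_sums:
  fixes A :: "nat \<Rightarrow> 'a::topological_space set"
  assumes \<nu>: "signed_measure \<nu>" and A: "\<And>n. A n \<in> sets borel" and disj: "disjoint_family A"
  shows "(\<lambda>n. pos_var \<nu> (A n)) sums pos_var \<nu> (\<Union>n. A n)"
proof -
  have partial_sums_le: "(\<Sum>i<n. pos_var \<nu> (A i)) \<le> pos_var \<nu> (\<Union>n. A n)" for n
  proof -
    have "(\<Sum>i<n. pos_var \<nu> (A i)) \<le> pos_var \<nu> (\<Union>i<n. A i)"
      by (intro sum_pos_var_le[OF \<nu>] disjoint_family_on_mono[OF _ disj]) auto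
    also have "\<dots> \<le> pos_var \<nu> (\<Union>n. A n)" by (intro pos_var_mono[OF \<nu>]) auto
    finally show ?thesis .
  qed
  have summable: "summable (\<lambda>n. pos_var \<nu> (A n))"
    by (intro summableI_nonneg_bounded[OF _ partial_sums_le] pos_var_nonneg[OF \<nu>])
  have "pos_var \<nu> (\<Union>n. A n) \<le> (\<Sum>n. pos_var \<nu> (A n))"
  proof (rule pos_var_least)
    fix B assume B: "B \<in> sets borel" "B \<subseteq> (\<Union>n. A n)"
    have "(\<lambda>n. \<nu> (B \<inter> A n)) sums \<nu> (\<Union>n. B \<inter> A n)"
      using A B disj by (intro signed_measure_sums[OF \<nu>]) (auto intro: disjoint_family_subset)
    moreover have "(\<Union>n. B \<inter> A n) = B" using B by auto
    moreover have "\<nu> (B \<inter> A n) \<le> pos_var \<nu> (A n)" for n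
      using A B by (intro pos_var_upper[OF \<nu>]) auto
    ultimately show "\<nu> B \<le> (\<Sum>n. pos_var \<nu> (A n))"
      using sums_le[of "\<lambda>n. \<nu> (B \<inter> A n)", OF _ _ summable_sums[OF summable]] by simp
  qed
  moreover have "(\<Sum>n. pos_var \<nu> (A n)) \<le> pos_var \<nu> (\<Union>n. A n)"
    using summable partial_sums_le by (rule suminf_le_const)
  ultimately show ?thesis using summable by (simp add: sums_iff)
qed

lemma space_pos_var_measure [simp]: "space (pos_var_measure \<nu>) = UNIV"
  by (simp add: pos_var_measure_def space_measure_of_conv)

lemma sets_pos_var_measure [simp, measurable_cong]: "sets (pos_var_measure \<nu>) = sets borel"
  unfolding pos_var_measure_def
  by (subst sets_measure_of) (auto simp: sets.sigma_sets_eq[of borel, simplified])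

lemma emeasure_pos_var_measure:
  assumes \<nu>: "signed_measure \<nu>" and "A \<in> sets borel"
  shows "emeasure (pos_var_measure \<nu>) A = ennreal (pos_var \<nu> A)"
proof (rule emeasure_measure_of[OF pos_var_measure_def])
  show "positive (sets (pos_var_measure \<nu>)) (\<lambda>A. ennreal (pos_var \<nu> A))"
    by (simp add: positive_def pos_var_empty[OF \<nu>])
  show "countably_additive (sets (pos_var_measure \<nu>)) (\<lambda>A. ennreal (pos_var \<nu> A))"
  proof (rule countably_additiveI)
    fix A :: "nat \<Rightarrow> _" assume "range A \<subseteq> sets (pos_var_measure \<nu>)" "disjoint_family A"
    then have "(\<lambda>n. pos_var \<nu> (A n)) sums pos_var \<nu> (\<Union>n. A n)"
      by (intro pos_var_sums[OF \<nu>]) auto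
    then show "(\<Sum>i. ennreal (pos_var \<nu> (A i))) = ennreal (pos_var \<nu> (\<Union> (range A)))"
      by (subst suminf_ennreal2) (auto simp: sums_iff pos_var_nonneg[OF \<nu>])
  qed
qed (use assms in auto)

lemma measure_pos_var_measure:
  "signed_measure \<nu> \<Longrightarrow> A \<in> sets borel \<Longrightarrow> measure (pos_var_measure \<nu>) A = pos_var \<nu> A"
  by (simp add: measure_def emeasure_pos_var_measure pos_var_nonneg)

lemma finite_measure_pos_var_measure:
  "signed_measure \<nu> \<Longrightarrow> finite_measure (pos_var_measure \<nu>)"
  by (intro finite_measureI) (simp add: emeasure_pos_var_measure)

section \<open>The total variation norm\<close>

lemma sum_abs_le_variation:
  fixes A :: "nat \<Rightarrow> 'a::topological_space set"
  assumes \<nu>: "signed_measure \<nu>" and A: "\<And>i. i < n \<Longrightarrow> A i \<in> sets borel"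
    and disj: "disjoint_family_on A {..<n}"
  shows "(\<Sum>i<n. \<bar>\<nu> (A i)\<bar>) \<le> pos_var \<nu> UNIV + neg_var \<nu> UNIV"
proof -
  have "(\<Sum>i<n. \<bar>\<nu> (A i)\<bar>) \<le> (\<Sum>i<n. pos_var \<nu> (A i) + neg_var \<nu> (A i))"
    using A by (intro sum_mono abs_le_pos_var_plus_neg_var[OF \<nu>]) simp
  also have "\<dots> = (\<Sum>i<n. pos_var \<nu> (A i)) + (\<Sum>i<n. neg_var \<nu> (A i))"
    by (rule sum.distrib)
  also have "\<dots> \<le> pos_var \<nu> UNIV + neg_var \<nu> UNIV"
    using \<nu> signed_measure_minus[OF \<nu>] disj
    by (intro add_mono order_trans[OF sum_pos_var_le pos_var_mono]) auto
  finally show ?thesis .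
qed

lemma tv_norm_le:
  assumes "signed_measure \<nu>"
  shows "tv_norm \<nu> \<le> pos_var \<nu> UNIV + neg_var \<nu> UNIV"
  unfolding tv_norm_def
  by (rule cSup_least)
    (auto intro!: sum_abs_le_variation[OF assms] exI[of _ 0] simp: disjoint_family_on_def)

lemma abs_le_tv_norm:
  assumes \<nu>: "signed_measure \<nu>" and A: "A \<in> sets borel"
  shows "\<bar>\<nu> A\<bar> \<le> tv_norm \<nu>"
  unfolding tv_norm_def
proof (rule cSup_upper)
  show "\<bar>\<nu> A\<bar> \<in> {(\<Sum>i<n. \<bar>\<nu> (A i)\<bar>) | (n::nat) A.
      (\<forall>i<n. A i \<in> sets borel) \<and> disjoint_family_on A {..<n}}"
    using A by (intro CollectI exI[of _ "1::nat"] exI[of _ "\<lambda>_. A"]) (auto simp: disjoint_family_on_def)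
qed (auto intro!: bdd_aboveI sum_abs_le_variation[OF \<nu>])

lemma tv_norm_nonneg: "signed_measure \<nu> \<Longrightarrow> 0 \<le> tv_norm \<nu>"
  using abs_le_tv_norm[of \<nu> "{}"] by (simp add: signed_measure_empty)

lemma tv_norm_cong:
  assumes "\<And>A. A \<in> sets borel \<Longrightarrow> \<nu> A = \<rho> A"
  shows "tv_norm \<nu> = tv_norm \<rho>"
  unfolding tv_norm_def using assms
  by (intro arg_cong[where f = Sup] Collect_cong ex_cong1 rev_conj_cong) auto

section \<open>Integration against signed measures\<close>

lemma signed_integral_cong:
  assumes "\<And>A. A \<in> sets borel \<Longrightarrow> \<nu> A = \<rho> A"
  shows "signed_integral \<nu> f = signed_integral \<rho> f"
  using pos_var_cong[of \<nu> \<rho>] pos_var_cong[of "\<lambda>A. - \<nu> A" "\<lambda>A. - \<rho> A"] assms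
  by (simp add: signed_integral_def pos_var_measure_def)

lemma integrable_pos_var_measure:
  fixes f :: "'a::topological_space \<Rightarrow> real"
  assumes "signed_measure \<nu>" "f \<in> borel_measurable borel" "bounded (range f)"
  shows "integrable (pos_var_measure \<nu>) f"
proof -
  obtain c where "\<And>x. norm (f x) \<le> c" using assms(3) by (auto simp: bounded_iff)
  then show ?thesis
    using assms by (intro finite_measure.integrable_const_bound finite_measure_pos_var_measure) auto
qed

lemma signed_integral_of_nonneg:
  assumes "nonneg_measure \<mu>"
  shows "signed_integral \<mu> f = (\<integral>x. f x \<partial>pos_var_measure \<mu>)"
proof -
  let ?N = "pos_var_measure (\<lambda>A. - \<mu> A)"
  have "space ?N \<in> null_sets ?N"
    using assms nonneg_measureD(1)[OF assms]
    by (simp add: null_sets_def emeasure_pos_var_measure signed_measure_minus neg_var_eq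
        pos_var_of_nonneg)
  then have "AE x in ?N. f x = 0" by (rule AE_I') auto
  then show ?thesis by (simp add: signed_integral_def integral_eq_zero_AE)
qed

lemma signed_integral_indicator:
  assumes "signed_measure \<nu>" "A \<in> sets borel"
  shows "signed_integral \<nu> (indicator A) = \<nu> A"
  using assms by (simp add: signed_integral_def measure_pos_var_measure signed_measure_minus neg_var_eq)

lemma signed_integral_cmult: "signed_integral \<nu> (\<lambda>x. c * f x) = c * signed_integral \<nu> f"
  by (simp add: signed_integral_def right_diff_distrib)

lemma signed_integral_sum:
  assumes "signed_measure \<nu>"
    and "\<And>i. i \<in> I \<Longrightarrow> f i \<in> borel_measurable borel" "\<And>i. i \<in> I \<Longrightarrow> bounded (range (f i))"
  shows "signed_integral \<nu> (\<lambda>x. \<Sum>i\<in>I. f i x) = (\<Sum>i\<in>I. signed_integral \<nu> (f i))"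
  using assms
  by (simp add: signed_integral_def integrable_pos_var_measure signed_measure_minus sum_subtractf)

lemma signed_integral_simple_function:
  assumes \<nu>: "signed_measure \<nu>" and s: "simple_function borel s"
  shows "signed_integral \<nu> s = (\<Sum>y\<in>range s. y * \<nu> (s -` {y}))"
proof -
  have level_sets: "s -` {y} \<in> sets borel" for y
    using simple_functionD(2)[OF s, of "{y}"] by simp
  have "s x = (\<Sum>y\<in>range s. y * indicator (s -` {y}) x)" for x
    by (subst simple_function_indicator_representation_banach[OF s]) (simp_all add: mult.commute)
  then have "signed_integral \<nu> s = signed_integral \<nu> (\<lambda>x. \<Sum>y\<in>range s. y * indicator (s -` {y}) x)"
    by (intro arg_cong[where f = "signed_integral \<nu>"] ext)
  also have "\<dots> = (\<Sum>y\<in>range s. signed_integral \<nu> (\<lambda>x. y * indicator (s -` {y}) x))"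
  proof (rule signed_integral_sum[OF \<nu>])
    show "bounded (range (\<lambda>x. y * indicator (s -` {y}) x))" for y
      by (rule boundedI[of _ "\<bar>y\<bar>"]) (auto simp: indicator_def)
  qed (use level_sets in auto)
  also have "\<dots> = (\<Sum>y\<in>range s. y * \<nu> (s -` {y}))"
    by (simp add: signed_integral_cmult signed_integral_indicator \<nu> level_sets)
  finally show ?thesis .
qed

lemma signed_integral_tendsto:
  fixes f :: "nat \<Rightarrow> 'a::topological_space \<Rightarrow> real"
  assumes "signed_measure \<nu>" "\<And>i. f i \<in> borel_measurable borel" "\<And>i x. \<bar>f i x\<bar> \<le> c"
    and "\<And>x. (\<lambda>i. f i x) \<longlonglongrightarrow> g x" "g \<in> borel_measurable borel"
  shows "(\<lambda>i. signed_integral \<nu> (f i)) \<longlonglongrightarrow> signed_integral \<nu> g"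
proof -
  have "(\<lambda>i. \<integral>x. f i x \<partial>pos_var_measure \<rho>) \<longlonglongrightarrow> (\<integral>x. g x \<partial>pos_var_measure \<rho>)"
    if "signed_measure \<rho>" for \<rho>
    using assms that
    by (intro integral_dominated_convergence[where w = "\<lambda>_. c"] integrable_pos_var_measure) auto
  then show ?thesis
    unfolding signed_integral_def using assms(1) signed_measure_minus
    by (intro tendsto_diff) blast+
qed

lemma signed_integral_lincomb:
  assumes \<nu>: "signed_measure \<nu>" and \<rho>: "signed_measure \<rho>"
    and f: "f \<in> borel_measurable borel" "bounded (range f)"
  shows "signed_integral (\<lambda>A. a * \<nu> A + b * \<rho> A) f = a * signed_integral \<nu> f + b * signed_integral \<rho> f"
proof -
  obtain s where simple: "\<And>i. simple_function borel (s i)" and lim: "\<And>x. (\<lambda>i. s i x) \<longlonglongrightarrow> f x"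
    and s_le: "\<And>i x. \<bar>s i x\<bar> \<le> 2 * \<bar>f x\<bar>"
    using borel_measurable_implies_sequence_metric[OF f(1), of 0] by auto
  obtain c where "\<And>x. \<bar>f x\<bar> \<le> c" using f(2) by (auto simp: bounded_iff)
  then have bound: "\<bar>s i x\<bar> \<le> 2 * c" for i x
    using s_le[of i x] by (meson mult_left_mono order_trans zero_le_numeral)
  have tendsto: "(\<lambda>i. signed_integral \<tau> (s i)) \<longlonglongrightarrow> signed_integral \<tau> f" if "signed_measure \<tau>" for \<tau>
    using borel_measurable_simple_function[OF simple]
    by (intro signed_integral_tendsto[OF that _ bound lim f(1)])
  have "signed_integral (\<lambda>A. a * \<nu> A + b * \<rho> A) (s i)
      = a * signed_integral \<nu> (s i) + b * signed_integral \<rho> (s i)" for i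
    by (simp add: signed_integral_simple_function signed_measure_lincomb \<nu> \<rho> simple
        sum_distrib_left sum.distrib algebra_simps)
  then have "(\<lambda>i. signed_integral (\<lambda>A. a * \<nu> A + b * \<rho> A) (s i))
      \<longlonglongrightarrow> a * signed_integral \<nu> f + b * signed_integral \<rho> f"
    by (auto intro!: tendsto_intros tendsto \<nu> \<rho>)
  then show ?thesis
    using tendsto[OF signed_measure_lincomb[OF \<nu> \<rho>]] LIMSEQ_unique by blast
qed

lemma prob_signed_measureD:
  assumes "prob_signed_measure \<nu>"
  shows "signed_measure \<nu>" "nonneg_measure \<nu>" "\<nu> UNIV = 1"
  using assms by (auto simp: prob_signed_measure_def nonneg_measure_def)

lemma measure_pos_var_measure_of_nonneg:
  "nonneg_measure \<mu> \<Longrightarrow> A \<in> sets borel \<Longrightarrow> measure (pos_var_measure \<mu>) A = \<mu> A"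
  by (simp add: measure_pos_var_measure pos_var_of_nonneg nonneg_measureD(1))

lemma prob_signed_measure_dirac: "prob_signed_measure (\<lambda>A. indicator A x)"
  unfolding prob_signed_measure_def signed_measure_def
  by (auto intro!: indicator_sums dest: disjoint_family_onD)

lemma signed_integral_dirac:
  fixes f :: "'a::topological_space \<Rightarrow> real"
  assumes [measurable]: "f \<in> borel_measurable borel"
  shows "signed_integral (\<lambda>A. indicator A x) f = f x"
proof -
  let ?M = "pos_var_measure (\<lambda>A. indicator A x :: real)"
  note dirac = prob_signed_measureD[OF prob_signed_measure_dirac[of x]]
  interpret finite_measure ?M by (rule finite_measure_pos_var_measure[OF dirac(1)])
  have "{y. f y \<noteq> f x} \<in> sets borel" by measurable
  then have "{y. f y \<noteq> f x} \<in> null_sets ?M"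
    by (simp add: null_sets_def emeasure_eq_measure measure_pos_var_measure_of_nonneg[OF dirac(2)])
  then have "AE y in ?M. f y = f x" by (rule AE_I') auto
  then have "(\<integral>y. f y \<partial>?M) = (\<integral>y. f x \<partial>?M)" by (intro integral_cong_AE) auto
  also have "\<dots> = f x"
    using measure_pos_var_measure_of_nonneg[OF dirac(2), of UNIV] by simp
  finally show ?thesis by (simp add: signed_integral_of_nonneg[OF dirac(2)])
qed

section \<open>Absolute continuity\<close>

lemma (in finite_measure) measure_limsup_ge:
  assumes A: "\<And>n::nat. A n \<in> sets M" and measure_ge: "\<And>n. c \<le> measure M (A n)"
  shows "c \<le> measure M (limsup A)"
proof -
  have tails: "(\<Union>m\<in>{n..}. A m) \<in> sets M" for n
    using A by (intro sets.countable_UN') auto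
  have "decseq (\<lambda>n. \<Union>m\<in>{n..}. A m)"
    unfolding decseq_def by (intro allI impI UN_mono) auto
  then have "(\<lambda>n. measure M (\<Union>m\<in>{n..}. A m)) \<longlonglongrightarrow> measure M (limsup A)"
    unfolding limsup_INF_SUP using tails by (intro finite_Lim_measure_decseq) auto
  moreover have "c \<le> measure M (\<Union>m\<in>{n..}. A m)" for n
    using measure_ge[of n] by (rule order_trans) (auto intro!: finite_measure_mono tails)
  ultimately show ?thesis by (intro LIMSEQ_le_const) auto
qed

lemma frequently_mem_pair:
  assumes M: "finite_measure M" and N: "finite_measure N"
    and [measurable]: "\<And>n::nat. A n \<in> sets M" "\<And>n. B n \<in> sets N"
    and "0 < a" "0 < b" and measure_ge: "\<And>n. a \<le> measure M (A n)" "\<And>n. b \<le> measure N (B n)"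
  obtains x y where "\<exists>\<^sub>F n in sequentially. x \<in> A n \<and> y \<in> B n"
proof -
  interpret N: finite_measure N by fact
  interpret MN: finite_measure "M \<Otimes>\<^sub>M N" by (rule finite_measure_pair_measure[OF N M])
  have "a * b \<le> measure (M \<Otimes>\<^sub>M N) (A n \<times> B n)" for n
  proof -
    have "emeasure (M \<Otimes>\<^sub>M N) (A n \<times> B n) = emeasure M (A n) * emeasure N (B n)"
      by (intro N.emeasure_pair_measure_Times) auto
    then have "measure (M \<Otimes>\<^sub>M N) (A n \<times> B n) = measure M (A n) * measure N (B n)"
      by (simp add: measure_def enn2real_mult)
    then show ?thesis
      using measure_ge[of n] \<open>0 < a\<close> \<open>0 < b\<close> by (simp add: mult_mono)
  qed
  then have "a * b \<le> measure (M \<Otimes>\<^sub>M N) (limsup (\<lambda>n. A n \<times> B n))"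
    by (intro MN.measure_limsup_ge) auto
  moreover have "0 < a * b" using \<open>0 < a\<close> \<open>0 < b\<close> by simp
  ultimately have "limsup (\<lambda>n. A n \<times> B n) \<noteq> {}" by auto
  then show ?thesis using that by (auto simp: mem_limsup_iff)
qed

lemma absolutely_continuous_imp_small:
  assumes "absolutely_continuous M N" "finite_measure N" and [simp]: "sets N = sets M" and "0 < \<epsilon>"
  obtains \<delta> :: real where "0 < \<delta>"
    "\<And>A. A \<in> sets M \<Longrightarrow> emeasure M A < ennreal \<delta> \<Longrightarrow> measure N A < \<epsilon>"
proof (rule ccontr)
  interpret N: finite_measure N by fact
  assume "\<not> thesis"
  then have "\<exists>A\<in>sets M. emeasure M A < ennreal ((1/2) ^ n) \<and> \<epsilon> \<le> measure N A" for n :: nat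
    using that[of "(1/2) ^ n"] by (force simp: not_less)
  then obtain A where A: "\<And>n::nat. A n \<in> sets M" "\<And>n. emeasure M (A n) < ennreal ((1/2) ^ n)"
    and measure_ge: "\<And>n. \<epsilon> \<le> measure N (A n)"
    by metis
  have "measure M (A n) \<le> (1/2) ^ n" for n
    using A(2)[of n] unfolding measure_def by (intro enn2real_leI) auto
  then have "summable (\<lambda>n. measure M (A n))"
    by (intro summable_comparison_test'[OF summable_geometric[of "1/2::real"]]) auto
  moreover have "emeasure M (A n) < \<infinity>" for n
    using A(2)[of n] by (rule order.strict_trans) simp
  ultimately have "limsup A \<in> null_sets M"
    using A(1) by (intro borel_cantelli_limsup1)
  then have "limsup A \<in> null_sets N"
    using assms(1) unfolding absolutely_continuous_def by blast
  then show False
    using N.measure_limsup_ge[of A \<epsilon>] A(1) measure_ge \<open>0 < \<epsilon>\<close> by (simp add: measure_eq_0_null_sets)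
qed

definition abs_continuous :: "('a::topological_space set \<Rightarrow> real) \<Rightarrow> ('a set \<Rightarrow> real) \<Rightarrow> bool" where
  "abs_continuous \<mu> \<rho> \<longleftrightarrow> (\<forall>A\<in>sets borel. \<mu> A = 0 \<longrightarrow> \<rho> A = 0)"

lemma abs_continuous_minus: "abs_continuous \<mu> \<rho> \<Longrightarrow> abs_continuous \<mu> (\<lambda>A. - \<rho> A)"
  by (simp add: abs_continuous_def)

lemma absolutely_continuous_pos_var_measure:
  assumes \<mu>: "nonneg_measure \<mu>" and \<rho>: "signed_measure \<rho>" and ac: "abs_continuous \<mu> \<rho>"
  shows "absolutely_continuous (pos_var_measure \<mu>) (pos_var_measure \<rho>)"
  unfolding absolutely_continuous_def
proof
  fix A assume "A \<in> null_sets (pos_var_measure \<mu>)"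
  then have A: "A \<in> sets borel" and "\<mu> A = 0"
    using \<mu> nonneg_measureD[OF \<mu>]
    by (auto simp: null_sets_def emeasure_pos_var_measure pos_var_of_nonneg)
  have "\<rho> B \<le> 0" if B: "B \<in> sets borel" "B \<subseteq> A" for B
  proof -
    have "\<mu> B = 0"
      using nonneg_measure_mono[OF \<mu> B(1) A B(2)] nonneg_measureD(2)[OF \<mu> B(1)] \<open>\<mu> A = 0\<close> by simp
    then show ?thesis using ac B(1) by (simp add: abs_continuous_def)
  qed
  then have "pos_var \<rho> A = 0" by (intro antisym pos_var_least pos_var_nonneg[OF \<rho>])
  then show "A \<in> null_sets (pos_var_measure \<rho>)"
    using A by (simp add: null_sets_def emeasure_pos_var_measure[OF \<rho>])
qed

lemma abs_continuous_imp_pos_var_small: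
  assumes \<mu>: "nonneg_measure \<mu>" and \<rho>: "signed_measure \<rho>" and ac: "abs_continuous \<mu> \<rho>" and "0 < \<epsilon>"
  obtains \<delta> where "0 < \<delta>" "\<And>A. A \<in> sets borel \<Longrightarrow> \<mu> A < \<delta> \<Longrightarrow> pos_var \<rho> A < \<epsilon>"
proof -
  obtain \<delta> where "0 < \<delta>" and \<delta>: "\<And>A. A \<in> sets (pos_var_measure \<mu>) \<Longrightarrow>
      emeasure (pos_var_measure \<mu>) A < ennreal \<delta> \<Longrightarrow> measure (pos_var_measure \<rho>) A < \<epsilon>"
    using absolutely_continuous_imp_small[OF absolutely_continuous_pos_var_measure[OF \<mu> \<rho> ac]
        finite_measure_pos_var_measure[OF \<rho>] _ \<open>0 < \<epsilon>\<close>] by auto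
  have "pos_var \<rho> A < \<epsilon>" if "A \<in> sets borel" "\<mu> A < \<delta>" for A
    using \<delta>[of A] that \<mu> nonneg_measureD[OF \<mu>] \<open>0 < \<delta>\<close>
    by (simp add: emeasure_pos_var_measure pos_var_of_nonneg measure_pos_var_measure[OF \<rho>]
        ennreal_less_iff)
  with \<open>0 < \<delta>\<close> show ?thesis by (rule that)
qed

definition dominated_up_to ::
    "real \<Rightarrow> real \<Rightarrow> ('a::topological_space set \<Rightarrow> real) \<Rightarrow> ('a set \<Rightarrow> real) \<Rightarrow> bool" where
  "dominated_up_to \<epsilon> C \<mu> \<nu> \<longleftrightarrow> (\<forall>A\<in>sets borel. \<bar>\<nu> A\<bar> \<le> C * \<mu> A + \<epsilon>)"

lemma dominated_up_to_minus: "dominated_up_to \<epsilon> C \<mu> \<nu> \<Longrightarrow> dominated_up_to \<epsilon> C \<mu> (\<lambda>A. - \<nu> A)"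
  by (simp add: dominated_up_to_def)

lemma pos_var_le_of_dominated_up_to:
  assumes \<mu>: "nonneg_measure \<mu>" and dom: "dominated_up_to \<epsilon> C \<mu> \<nu>"
    and "0 \<le> C" and A: "A \<in> sets borel"
  shows "pos_var \<nu> A \<le> C * \<mu> A + \<epsilon>"
proof (rule pos_var_least)
  fix B assume B: "B \<in> sets borel" "B \<subseteq> A"
  have "\<nu> B \<le> C * \<mu> B + \<epsilon>"
    using dom B(1) unfolding dominated_up_to_def by (meson abs_le_D1)
  also have "\<dots> \<le> C * \<mu> A + \<epsilon>"
    using nonneg_measure_mono[OF \<mu> B(1) A B(2)] \<open>0 \<le> C\<close> by (simp add: mult_left_mono)
  finally show "\<nu> B \<le> C * \<mu> A + \<epsilon>" .
qed

text \<open>Sets of \<open>\<mu>\<close>-measure below the threshold \<open>\<delta>\<close> contribute at most \<open>\<epsilon>\<close>; on the others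
  \<open>C = K/\<delta>\<close> works, where \<open>K\<close> bounds \<open>\<bar>\<nu>\<bar>\<close>.\<close>
lemma abs_continuous_imp_dominated_up_to:
  assumes \<mu>: "nonneg_measure \<mu>" and \<nu>: "signed_measure \<nu>" and ac: "abs_continuous \<mu> \<nu>" and "0 < \<epsilon>"
  obtains C where "0 < C" "dominated_up_to \<epsilon> C \<mu> \<nu>"
proof -
  obtain K where K: "\<And>A. A \<in> sets borel \<Longrightarrow> \<bar>\<nu> A\<bar> \<le> K"
    using signed_measure_bounded[OF \<nu>] by blast
  obtain \<delta>\<^sub>1 where "0 < \<delta>\<^sub>1" and \<delta>\<^sub>1: "\<And>A. A \<in> sets borel \<Longrightarrow> \<mu> A < \<delta>\<^sub>1 \<Longrightarrow> pos_var \<nu> A < \<epsilon> / 2"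
    using abs_continuous_imp_pos_var_small[OF \<mu> \<nu> ac, of "\<epsilon> / 2"] \<open>0 < \<epsilon>\<close> by auto
  obtain \<delta>\<^sub>2 where "0 < \<delta>\<^sub>2" and \<delta>\<^sub>2: "\<And>A. A \<in> sets borel \<Longrightarrow> \<mu> A < \<delta>\<^sub>2 \<Longrightarrow> neg_var \<nu> A < \<epsilon> / 2"
    using abs_continuous_imp_pos_var_small[OF \<mu> signed_measure_minus[OF \<nu>]
        abs_continuous_minus[OF ac], of "\<epsilon> / 2"] \<open>0 < \<epsilon>\<close> by auto
  define \<delta> where "\<delta> = min \<delta>\<^sub>1 \<delta>\<^sub>2"
  define C where "C = (\<bar>K\<bar> + 1) / \<delta>"
  have "0 < \<delta>" using \<open>0 < \<delta>\<^sub>1\<close> \<open>0 < \<delta>\<^sub>2\<close> by (simp add: \<delta>_def)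
  then have "0 < C" by (simp add: C_def)
  moreover have "\<bar>\<nu> A\<bar> \<le> C * \<mu> A + \<epsilon>" if A: "A \<in> sets borel" for A
  proof (cases "\<mu> A < \<delta>")
    case True
    then have "\<bar>\<nu> A\<bar> \<le> \<epsilon>"
      using abs_le_pos_var_plus_neg_var[OF \<nu> A] \<delta>\<^sub>1[OF A] \<delta>\<^sub>2[OF A] by (simp add: \<delta>_def)
    moreover have "0 \<le> C * \<mu> A" using \<open>0 < C\<close> nonneg_measureD(2)[OF \<mu> A] by simp
    ultimately show ?thesis by simp
  next
    case False
    then have "C * \<delta> \<le> C * \<mu> A" using \<open>0 < C\<close> by simp
    then show ?thesis using K[OF A] \<open>0 < \<delta>\<close> \<open>0 < \<epsilon>\<close> by (simp add: C_def)
  qed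
  ultimately show ?thesis by (intro that[of C]) (simp_all add: dominated_up_to_def)
qed

section \<open>Markov kernels\<close>

lemma kernel_op_cong:
  "(\<And>A. A \<in> sets borel \<Longrightarrow> \<nu> A = \<rho> A) \<Longrightarrow> kernel_op p \<nu> = kernel_op p \<rho>"
  by (rule ext) (simp add: kernel_op_def signed_integral_cong[of \<nu> \<rho>])

locale markov_kernel =
  fixes p :: "'a::topological_space \<Rightarrow> 'a set \<Rightarrow> real"
  assumes prob: "prob_signed_measure (p x)"
    and measurable_kernel [measurable]: "A \<in> sets borel \<Longrightarrow> (\<lambda>x. p x A) \<in> borel_measurable borel"
begin

lemmas signed_measure_kernel = prob_signed_measureD(1)[OF prob]
lemmas kernel_nonneg = nonneg_measureD(2)[OF prob_signed_measureD(2)[OF prob]]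
lemmas kernel_UNIV = prob_signed_measureD(3)[OF prob]

lemma kernel_le_1: "A \<in> sets borel \<Longrightarrow> p x A \<le> 1"
  using nonneg_measure_mono[OF prob_signed_measureD(2)[OF prob], of A UNIV x]
  by (simp add: kernel_UNIV)

lemma bounded_kernel_range: "A \<in> sets borel \<Longrightarrow> bounded (range (\<lambda>x. p x A))"
  by (intro boundedI[of _ 1]) (auto simp: kernel_nonneg kernel_le_1)

lemma integrable_kernel:
  "signed_measure \<nu> \<Longrightarrow> A \<in> sets borel \<Longrightarrow> integrable (pos_var_measure \<nu>) (\<lambda>x. p x A)"
  by (intro integrable_pos_var_measure bounded_kernel_range) auto

lemma kernel_op_dirac: "A \<in> sets borel \<Longrightarrow> kernel_op p (\<lambda>A. indicator A x) A = p x A"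
  by (simp add: kernel_op_def signed_integral_dirac)

lemma kernel_op_lincomb:
  assumes "signed_measure \<nu>" "signed_measure \<rho>" "A \<in> sets borel"
  shows "kernel_op p (\<lambda>A. a * \<nu> A + b * \<rho> A) A = a * kernel_op p \<nu> A + b * kernel_op p \<rho> A"
  unfolding kernel_op_def using assms
  by (intro signed_integral_lincomb bounded_kernel_range) auto

lemma kernel_op_UNIV: "signed_measure \<nu> \<Longrightarrow> kernel_op p \<nu> UNIV = \<nu> UNIV"
  using signed_integral_indicator[of \<nu> UNIV]
  by (simp add: kernel_op_def kernel_UNIV indicator_def)

lemma signed_measure_kernel_op:
  assumes \<nu>: "signed_measure \<nu>"
  shows "signed_measure (kernel_op p \<nu>)"
  unfolding signed_measure_def
proof (intro conjI allI impI)
  show "kernel_op p \<nu> {} = 0"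
    by (simp add: kernel_op_def signed_measure_empty[OF signed_measure_kernel] signed_integral_def)
  fix A :: "nat \<Rightarrow> 'a set" assume "range A \<subseteq> sets borel" and disj: "disjoint_family A"
  then have A [measurable]: "A i \<in> sets borel" for i by auto
  have sums: "(\<lambda>i. p x (A i)) sums p x (\<Union>i. A i)" for x
    using A disj by (intro signed_measure_sums[OF signed_measure_kernel])
  have bound: "\<bar>\<Sum>i<n. p x (A i)\<bar> \<le> 1" for n x
  proof -
    have "(\<Sum>i<n. p x (A i)) \<le> p x (\<Union>i. A i)"
      using sums[of x] kernel_nonneg[OF A] by (metis sum_le_suminf finite_lessThan sums_iff)
    also have "\<dots> \<le> 1" by (intro kernel_le_1) measurable
    finally show ?thesis by (simp add: sum_nonneg kernel_nonneg)
  qed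
  have "(\<lambda>n. signed_integral \<nu> (\<lambda>x. \<Sum>i<n. p x (A i))) \<longlonglongrightarrow> kernel_op p \<nu> (\<Union>i. A i)"
    unfolding kernel_op_def using sums
    by (intro signed_integral_tendsto[OF \<nu>, where c = 1]) (auto simp: bound sums_def)
  moreover have "signed_integral \<nu> (\<lambda>x. \<Sum>i<n. p x (A i)) = (\<Sum>i<n. kernel_op p \<nu> (A i))" for n
    unfolding kernel_op_def by (intro signed_integral_sum[OF \<nu>] bounded_kernel_range) auto
  ultimately show "(\<lambda>i. kernel_op p \<nu> (A i)) sums kernel_op p \<nu> (\<Union>i. A i)"
    by (simp add: sums_def)
qed

lemma integral_kernel_le:
  assumes \<nu>: "signed_measure \<nu>" and "A \<in> sets borel"
  shows "(\<integral>x. p x A \<partial>pos_var_measure \<nu>) \<le> pos_var \<nu> UNIV"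
proof -
  interpret finite_measure "pos_var_measure \<nu>"
    by (rule finite_measure_pos_var_measure[OF \<nu>])
  have "(\<integral>x. p x A \<partial>pos_var_measure \<nu>) \<le> (\<integral>x. 1 \<partial>pos_var_measure \<nu>)"
    using assms by (intro integral_mono integrable_kernel) (auto simp: kernel_le_1)
  also have "\<dots> = pos_var \<nu> UNIV" using measure_pos_var_measure[OF \<nu>, of UNIV] by simp
  finally show ?thesis .
qed

lemma kernel_op_le_integral_pos_part:
  assumes "signed_measure \<nu>" "A \<in> sets borel"
  shows "kernel_op p \<nu> A \<le> (\<integral>x. p x A \<partial>pos_var_measure \<nu>)"
  using assms by (simp add: kernel_op_def signed_integral_def kernel_nonneg)

lemma kernel_op_le_pos_var:
  assumes "signed_measure \<nu>" "A \<in> sets borel"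
  shows "kernel_op p \<nu> A \<le> pos_var \<nu> UNIV"
  using kernel_op_le_integral_pos_part[OF assms] integral_kernel_le[OF assms] by linarith

lemma pos_var_kernel_op_le:
  "signed_measure \<nu> \<Longrightarrow> pos_var (kernel_op p \<nu>) UNIV \<le> pos_var \<nu> UNIV"
  by (intro pos_var_least kernel_op_le_pos_var)

lemma kernel_op_mono_up_to:
  assumes \<nu>: "signed_measure \<nu>" and \<rho>: "signed_measure \<rho>"
    and \<nu>_le: "\<And>A. A \<in> sets borel \<Longrightarrow> \<nu> A \<le> \<rho> A + \<epsilon>" and A: "A \<in> sets borel"
  shows "kernel_op p \<nu> A \<le> kernel_op p \<rho> A + \<epsilon>"
proof -
  let ?diff = "\<lambda>A. 1 * \<nu> A + (- 1) * \<rho> A"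
  have "kernel_op p \<nu> A - kernel_op p \<rho> A = kernel_op p ?diff A"
    by (subst kernel_op_lincomb[OF \<nu> \<rho> A]) simp
  also have "\<dots> \<le> pos_var ?diff UNIV"
    by (rule kernel_op_le_pos_var[OF signed_measure_lincomb[OF \<nu> \<rho>] A])
  also have "\<dots> \<le> \<epsilon>" using \<nu>_le by (intro pos_var_least) (simp add: algebra_simps)
  finally show ?thesis by simp
qed

definition stationary :: "('a set \<Rightarrow> real) \<Rightarrow> bool" where
  "stationary \<mu> \<longleftrightarrow> (\<forall>A\<in>sets borel. kernel_op p \<mu> A = \<mu> A)"

lemma dominated_up_to_kernel_op:
  assumes \<mu>: "signed_measure \<mu>" and stationary: "stationary \<mu>"
    and \<nu>: "signed_measure \<nu>" and dom: "dominated_up_to \<epsilon> C \<mu> \<nu>"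
  shows "dominated_up_to \<epsilon> C \<mu> (kernel_op p \<nu>)"
proof -
  have C\<mu>: "signed_measure (\<lambda>A. c * \<mu> A)" for c
    using signed_measure_lincomb[OF \<mu> \<mu>, of c 0] by simp
  have kernel_op_C\<mu>: "kernel_op p (\<lambda>A. c * \<mu> A) A = c * \<mu> A" if "A \<in> sets borel" for c A
    using kernel_op_lincomb[OF \<mu> \<mu> that, of c 0] stationary that by (simp add: stationary_def)
  have bounds: "\<nu> A \<le> C * \<mu> A + \<epsilon>" "- C * \<mu> A \<le> \<nu> A + \<epsilon>" if "A \<in> sets borel" for A
    using dom that unfolding dominated_up_to_def abs_le_iff by (auto simp: algebra_simps)
  have "kernel_op p \<nu> A \<le> C * \<mu> A + \<epsilon>" "- C * \<mu> A \<le> kernel_op p \<nu> A + \<epsilon>" if "A \<in> sets borel" for A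
    using kernel_op_mono_up_to[OF \<nu> C\<mu> bounds(1) that] kernel_op_mono_up_to[OF C\<mu> \<nu> bounds(2) that]
      kernel_op_C\<mu>[OF that, of C] kernel_op_C\<mu>[OF that, of "- C"] by simp_all
  then show ?thesis unfolding dominated_up_to_def abs_le_iff by (fastforce simp: algebra_simps)
qed

lemma signed_measure_funpow: "signed_measure \<nu> \<Longrightarrow> signed_measure ((kernel_op p ^^ n) \<nu>)"
  by (induction n) (simp_all add: signed_measure_kernel_op)

lemma funpow_UNIV: "signed_measure \<nu> \<Longrightarrow> (kernel_op p ^^ n) \<nu> UNIV = \<nu> UNIV"
  by (induction n) (simp_all add: kernel_op_UNIV signed_measure_funpow)

lemma dominated_up_to_funpow:
  assumes "signed_measure \<mu>" "stationary \<mu>"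
    and "signed_measure \<nu>" "dominated_up_to \<epsilon> C \<mu> \<nu>"
  shows "dominated_up_to \<epsilon> C \<mu> ((kernel_op p ^^ n) \<nu>)"
  using assms by (induction n) (simp_all add: dominated_up_to_kernel_op signed_measure_funpow)

end

section \<open>Regular kernels\<close>

lemma integral_pos_part_ge:
  fixes f :: "'a::topological_space \<Rightarrow> real"
  assumes \<mu>: "nonneg_measure \<mu>" and \<nu>: "signed_measure \<nu>" and dom: "dominated_up_to \<epsilon> C \<mu> \<nu>" and "0 \<le> C"
    and f [measurable]: "f \<in> borel_measurable borel"
    and f_nonneg: "\<And>x. 0 \<le> f x" and f_bounded: "bounded (range f)" and "0 < \<delta>"
    and mass: "r + C * \<mu> {x. f x < \<delta>} + \<epsilon> \<le> pos_var \<nu> UNIV"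
  shows "\<delta> * r \<le> (\<integral>x. f x \<partial>pos_var_measure \<nu>)"
proof -
  let ?M = "pos_var_measure \<nu>"
  interpret finite_measure ?M by (rule finite_measure_pos_var_measure[OF \<nu>])
  have level: "{x. f x < \<delta>} \<in> sets borel" by measurable
  have "r \<le> pos_var \<nu> UNIV - pos_var \<nu> {x. f x < \<delta>}"
    using pos_var_le_of_dominated_up_to[OF \<mu> dom \<open>0 \<le> C\<close> level] mass by simp
  also have "\<dots> = measure ?M (space ?M - {x. f x < \<delta>})"
    using finite_measure_compl[of "{x. f x < \<delta>}"] level
    by (simp add: measure_pos_var_measure[OF \<nu>])
  also have "space ?M - {x. f x < \<delta>} = {x\<in>space ?M. \<delta> \<le> f x}" by auto
  also have "measure ?M \<dots> \<le> (\<integral>x. f x \<partial>?M) / \<delta>"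
    using f_nonneg \<open>0 < \<delta>\<close> f_bounded
    by (intro integral_Markov_inequality_measure[where A = "{}"] integrable_pos_var_measure[OF \<nu>]) auto
  finally show ?thesis using \<open>0 < \<delta>\<close> by (simp add: field_simps)
qed

lemma (in markov_kernel) kernel_op_le_of_small_levels:
  assumes \<mu>: "nonneg_measure \<mu>" and \<nu>: "signed_measure \<nu>" "\<nu> UNIV = 0"
    and dom: "dominated_up_to \<epsilon> C \<mu> \<nu>" "0 \<le> C" and mass: "r + 2 * \<epsilon> \<le> pos_var \<nu> UNIV"
    and A: "A \<in> sets borel" and "0 < \<delta>"
    and small: "C * \<mu> {x. p x A < \<delta>} \<le> \<epsilon> \<or> C * \<mu> {x. 1 - \<delta> < p x A} \<le> \<epsilon>"
  shows "kernel_op p \<nu> A \<le> pos_var \<nu> UNIV - \<delta> * r"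
  using small
proof
  assume low: "C * \<mu> {x. p x A < \<delta>} \<le> \<epsilon>"
  have "r + 2 * \<epsilon> \<le> neg_var \<nu> UNIV" using mass \<nu> by (simp add: neg_var_eq)
  then have "\<delta> * r \<le> (\<integral>x. p x A \<partial>pos_var_measure (\<lambda>A. - \<nu> A))"
    using \<open>0 < \<delta>\<close> dom(2) A low
    by (intro integral_pos_part_ge[OF \<mu> signed_measure_minus[OF \<nu>(1)] dominated_up_to_minus[OF dom(1)]]
        bounded_kernel_range) (auto simp: kernel_nonneg)
  then show ?thesis
    using integral_kernel_le[OF \<nu>(1) A] by (simp add: kernel_op_def signed_integral_def)
next
  assume high: "C * \<mu> {x. 1 - \<delta> < p x A} \<le> \<epsilon>"
  interpret finite_measure "pos_var_measure \<nu>"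
    by (rule finite_measure_pos_var_measure[OF \<nu>(1)])
  have "{x. 1 - p x A < \<delta>} = {x. 1 - \<delta> < p x A}" by auto
  moreover have "bounded (range (\<lambda>x. 1 - p x A))"
    using A by (intro boundedI[of _ 1]) (auto simp: kernel_nonneg kernel_le_1)
  ultimately have "\<delta> * r \<le> (\<integral>x. 1 - p x A \<partial>pos_var_measure \<nu>)"
    using \<open>0 < \<delta>\<close> dom(2) A mass high
    by (intro integral_pos_part_ge[OF \<mu> \<nu>(1) dom(1)]) (auto simp: kernel_le_1)
  also have "\<dots> = pos_var \<nu> UNIV - (\<integral>x. p x A \<partial>pos_var_measure \<nu>)"
    using integrable_kernel[OF \<nu>(1) A] measure_pos_var_measure[OF \<nu>(1), of UNIV] by simp
  finally show ?thesis using kernel_op_le_integral_pos_part[OF \<nu>(1) A] by linarith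
qed

locale regular_kernel = markov_kernel +
  assumes equivalent: "equivalent_measures (p x) (p y)"
begin

lemma kernel_eq_0_iff: "A \<in> sets borel \<Longrightarrow> p x A = 0 \<longleftrightarrow> p y A = 0"
  using equivalent[of x y] by (simp add: equivalent_measures_def)

lemma kernel_op_eq_0:
  assumes "A \<in> sets borel" "p x A = 0"
  shows "kernel_op p \<nu> A = 0"
proof -
  have "p y A = 0" for y using kernel_eq_0_iff assms by blast
  then show ?thesis by (simp add: kernel_op_def signed_integral_def)
qed

lemma kernel_op_eq_0_iff:
  assumes \<nu>: "prob_signed_measure \<nu>" and A: "A \<in> sets borel"
  shows "kernel_op p \<nu> A = 0 \<longleftrightarrow> p x A = 0"
proof
  let ?M = "pos_var_measure \<nu>"
  note \<nu>_prob = prob_signed_measureD[OF \<nu>]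
  assume "kernel_op p \<nu> A = 0"
  then have "(\<integral>y. p y A \<partial>?M) = 0"
    by (simp add: kernel_op_def signed_integral_of_nonneg[OF \<nu>_prob(2)])
  then have "AE y in ?M. p y A = 0"
    using \<nu>_prob A
    by (subst (asm) integral_nonneg_eq_0_iff_AE) (auto simp: kernel_nonneg integrable_kernel)
  then have "AE y in ?M. p x A = 0"
    by (rule eventually_mono) (use kernel_eq_0_iff[OF A] in blast)
  moreover have "emeasure ?M (space ?M) \<noteq> 0"
    using \<nu>_prob by (simp add: emeasure_pos_var_measure pos_var_of_nonneg)
  then have "ae_filter ?M \<noteq> bot" by (simp add: ae_filter_eq_bot_iff)
  ultimately show "p x A = 0" by (simp add: eventually_const_iff)
qed (rule kernel_op_eq_0[OF A])

lemma not_frequently_separating: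
  assumes A: "\<And>n::nat. A n \<in> sets borel" and e: "e \<longlonglongrightarrow> 0"
  shows "\<not> (\<exists>\<^sub>F n in sequentially. p x (A n) < e n \<and> 1 - e n < p y (A n))"
proof
  assume frequently: "\<exists>\<^sub>F n in sequentially. p x (A n) < e n \<and> 1 - e n < p y (A n)"
  have "abs_continuous (p x) (p y)"
    using kernel_eq_0_iff by (auto simp: abs_continuous_def)
  then obtain \<delta> where "0 < \<delta>" and \<delta>: "\<And>B. B \<in> sets borel \<Longrightarrow> p x B < \<delta> \<Longrightarrow> pos_var (p y) B < 1/2"
    using abs_continuous_imp_pos_var_small[OF prob_signed_measureD(2)[OF prob] signed_measure_kernel,
        of x y "1/2"] by auto
  have "\<forall>\<^sub>F n in sequentially. e n < min \<delta> (1/2)"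
    using \<open>0 < \<delta>\<close> by (intro order_tendstoD(2)[OF e]) auto
  from frequently_eventually_frequently[OF frequently this]
  obtain n where "p x (A n) < e n" "1 - e n < p y (A n)" "e n < min \<delta> (1/2)"
    by (auto dest: frequently_ex)
  then have "p x (A n) < \<delta>" "1/2 < p y (A n)" by simp_all
  then show False
    using \<delta>[OF A, of n] pos_var_upper[OF signed_measure_kernel A order_refl, of y n] by simp
qed

text \<open>Otherwise there are sets \<open>A n\<close> that are almost null for many starting points and almost full for
  many others, with error \<open>2\<^sup>-\<^sup>n\<close>. Then a single pair \<open>(x, y)\<close> sees both behaviours for infinitely
  many \<open>n\<close>, because the product sets in question have measure bounded below.\<close>
lemma no_uniformly_separating_sets:
  assumes \<mu>: "nonneg_measure \<mu>" and "0 < c"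
  obtains \<delta> where "0 < \<delta>"
    "\<And>A. A \<in> sets borel \<Longrightarrow> \<mu> {x. p x A < \<delta>} < c \<or> \<mu> {x. 1 - \<delta> < p x A} < c"
proof (rule ccontr)
  let ?M = "pos_var_measure \<mu>"
  assume "\<not> thesis"
  then have "\<exists>A\<in>sets borel. c \<le> \<mu> {x. p x A < (1/2) ^ n} \<and> c \<le> \<mu> {x. 1 - (1/2) ^ n < p x A}"
    for n :: nat
    using that[of "(1/2) ^ n"] by (force simp: not_less)
  then obtain A where A [measurable]: "\<And>n::nat. A n \<in> sets borel"
    and measure_ge: "\<And>n. c \<le> \<mu> {x. p x (A n) < (1/2) ^ n}" "\<And>n. c \<le> \<mu> {x. 1 - (1/2) ^ n < p x (A n)}"
    by metis
  define E F where "E n = {x. p x (A n) < (1/2) ^ n}" and "F n = {x. 1 - (1/2) ^ n < p x (A n)}" for n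
  have E: "E n \<in> sets ?M" "c \<le> measure ?M (E n)" for n
    using measure_ge(1)[of n] unfolding E_def by (simp_all add: measure_pos_var_measure_of_nonneg[OF \<mu>])
  have F: "F n \<in> sets ?M" "c \<le> measure ?M (F n)" for n
    using measure_ge(2)[of n] unfolding F_def by (simp_all add: measure_pos_var_measure_of_nonneg[OF \<mu>])
  have finite: "finite_measure ?M"
    by (rule finite_measure_pos_var_measure[OF nonneg_measureD(1)[OF \<mu>]])
  obtain x y where "\<exists>\<^sub>F n in sequentially. x \<in> E n \<and> y \<in> F n"
    by (rule frequently_mem_pair[OF finite finite E(1) F(1) \<open>0 < c\<close> \<open>0 < c\<close> E(2) F(2)])
  then have "\<exists>\<^sub>F n in sequentially. p x (A n) < (1/2) ^ n \<and> 1 - (1/2) ^ n < p y (A n)"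
    by (simp add: E_def F_def)
  moreover have "(\<lambda>n. (1/2::real) ^ n) \<longlonglongrightarrow> 0" by (intro LIMSEQ_power_zero) simp
  ultimately show False using not_frequently_separating[of A "\<lambda>n. (1/2) ^ n" x y, OF A] by blast
qed

lemma pos_var_kernel_op_decrease:
  assumes \<mu>: "nonneg_measure \<mu>" and "0 < C" "0 < m"
  obtains \<eta> where "0 < \<eta>"
    "\<And>\<nu>. signed_measure \<nu> \<Longrightarrow> \<nu> UNIV = 0 \<Longrightarrow> dominated_up_to (m / 4) C \<mu> \<nu> \<Longrightarrow>
      m \<le> pos_var \<nu> UNIV \<Longrightarrow> pos_var (kernel_op p \<nu>) UNIV \<le> pos_var \<nu> UNIV - \<eta>"
proof -
  obtain \<delta> where "0 < \<delta>" and separation: "\<And>A. A \<in> sets borel \<Longrightarrow>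
      \<mu> {x. p x A < \<delta>} < m / (4 * C) \<or> \<mu> {x. 1 - \<delta> < p x A} < m / (4 * C)"
    using no_uniformly_separating_sets[OF \<mu>, of "m / (4 * C)"] \<open>0 < C\<close> \<open>0 < m\<close> by auto
  have small: "C * \<mu> {x. p x A < \<delta>} \<le> m / 4 \<or> C * \<mu> {x. 1 - \<delta> < p x A} \<le> m / 4"
    if "A \<in> sets borel" for A
    using separation[OF that] \<open>0 < C\<close> by (auto simp: field_simps)
  have "pos_var (kernel_op p \<nu>) UNIV \<le> pos_var \<nu> UNIV - \<delta> * (m / 2)"
    if "signed_measure \<nu>" "\<nu> UNIV = 0" "dominated_up_to (m / 4) C \<mu> \<nu>" "m \<le> pos_var \<nu> UNIV" for \<nu>
  proof (rule pos_var_least)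
    fix A :: "'a set" assume A: "A \<in> sets borel"
    show "kernel_op p \<nu> A \<le> pos_var \<nu> UNIV - \<delta> * (m / 2)"
      using that \<open>0 < C\<close> \<open>0 < \<delta>\<close>
      by (intro kernel_op_le_of_small_levels[OF \<mu> _ _ _ _ _ A _ small[OF A]]) auto
  qed
  then show ?thesis
    using \<open>0 < \<delta>\<close> \<open>0 < m\<close> by (intro that[of "\<delta> * (m / 2)"]) auto
qed

lemma pos_var_funpow_tendsto_0:
  assumes \<mu>: "nonneg_measure \<mu>" and stationary: "stationary \<mu>"
    and \<nu>: "signed_measure \<nu>" and "\<nu> UNIV = 0" and ac: "abs_continuous \<mu> \<nu>"
  shows "(\<lambda>n. pos_var ((kernel_op p ^^ n) \<nu>) UNIV) \<longlonglongrightarrow> 0"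
proof -
  let ?D = "\<lambda>n. pos_var ((kernel_op p ^^ n) \<nu>) UNIV"
  note signed = signed_measure_funpow[OF \<nu>]
  have "decseq ?D" by (rule decseq_SucI) (simp add: pos_var_kernel_op_le[OF signed])
  then obtain m where m: "?D \<longlonglongrightarrow> m" "\<And>n. m \<le> ?D n"
    using decseq_convergent[of ?D 0] pos_var_nonneg[OF signed] by blast
  have "m \<le> 0"
  proof (rule ccontr)
    assume "\<not> m \<le> 0"
    then have "0 < m" by simp
    then obtain C where "0 < C" and dom: "dominated_up_to (m / 4) C \<mu> \<nu>"
      using abs_continuous_imp_dominated_up_to[OF \<mu> \<nu> ac, of "m / 4"] by auto
    obtain \<eta> where "0 < \<eta>" and decrease:
      "\<And>\<rho>. signed_measure \<rho> \<Longrightarrow> \<rho> UNIV = 0 \<Longrightarrow> dominated_up_to (m / 4) C \<mu> \<rho> \<Longrightarrow>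
        m \<le> pos_var \<rho> UNIV \<Longrightarrow> pos_var (kernel_op p \<rho>) UNIV \<le> pos_var \<rho> UNIV - \<eta>"
      using pos_var_kernel_op_decrease[OF \<mu> \<open>0 < C\<close> \<open>0 < m\<close>] by blast
    have "dominated_up_to (m / 4) C \<mu> ((kernel_op p ^^ n) \<nu>)" for n
      by (rule dominated_up_to_funpow[OF nonneg_measureD(1)[OF \<mu>] stationary \<nu> dom])
    then have "?D (Suc n) \<le> ?D n - \<eta>" for n
      using decrease[OF signed, of n] funpow_UNIV[OF \<nu>, of n] \<open>\<nu> UNIV = 0\<close> m(2)[of n] by simp
    then have "m \<le> m - \<eta>"
      by (intro LIMSEQ_le[OF LIMSEQ_Suc[OF m(1)] tendsto_diff[OF m(1) tendsto_const]]) blast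
    then show False using \<open>0 < \<eta>\<close> by simp
  qed
  moreover have "0 \<le> m"
    using m(1) pos_var_nonneg[OF signed] by (intro LIMSEQ_le_const) auto
  ultimately show ?thesis using m(1) by simp
qed

end

section \<open>Convergence of regular semigroups\<close>

locale markov_semigroup =
  fixes k :: "real \<Rightarrow> 'a::topological_space \<Rightarrow> 'a set \<Rightarrow> real"
  assumes semigroup: "kernel_semigroup k" and markovian: "markovian k"
begin

lemma markov_kernel_at: "0 \<le> t \<Longrightarrow> markov_kernel (k t)"
  using semigroup markovian
  by unfold_locales (auto simp: markovian_def kernel_semigroup_def bounded_kernel_def)

lemmas signed_measure_semigroup = markov_kernel.signed_measure_kernel_op[OF markov_kernel_at]

lemma kernel_op_0: "signed_measure \<nu> \<Longrightarrow> A \<in> sets borel \<Longrightarrow> kernel_op (k 0) \<nu> A = \<nu> A"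
  using semigroup by (simp add: kernel_semigroup_def)

lemma kernel_op_add:
  "0 \<le> t \<Longrightarrow> 0 \<le> s \<Longrightarrow> signed_measure \<nu> \<Longrightarrow> A \<in> sets borel \<Longrightarrow>
    kernel_op (k (t + s)) \<nu> A = kernel_op (k t) (kernel_op (k s) \<nu>) A"
  using semigroup by (simp add: kernel_semigroup_def)

lemma chapman_kolmogorov:
  assumes "0 \<le> t" "0 \<le> s" and A: "A \<in> sets borel"
  shows "k (t + s) x A = kernel_op (k t) (k s x) A"
proof -
  have dirac: "kernel_op (k u) (\<lambda>A. indicator A x) A = k u x A" if "0 \<le> u" "A \<in> sets borel" for u A
    using that by (intro markov_kernel.kernel_op_dirac markov_kernel_at)
  have "k (t + s) x A = kernel_op (k (t + s)) (\<lambda>A. indicator A x) A"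
    using dirac assms by simp
  also have "\<dots> = kernel_op (k t) (kernel_op (k s) (\<lambda>A. indicator A x)) A"
    using assms by (intro kernel_op_add prob_signed_measureD(1)[OF prob_signed_measure_dirac])
  also have "\<dots> = kernel_op (k t) (k s x) A"
    using dirac[OF \<open>0 \<le> s\<close>] by (subst kernel_op_cong) auto
  finally show ?thesis .
qed

lemma kernel_op_multiple:
  assumes "0 \<le> t" and \<nu>: "signed_measure \<nu>" and "A \<in> sets borel"
  shows "kernel_op (k (real n * t)) \<nu> A = (kernel_op (k t) ^^ n) \<nu> A"
  using \<open>A \<in> sets borel\<close>
proof (induction n arbitrary: A)
  case 0
  then show ?case using \<nu> by (simp add: kernel_op_0)
next
  case (Suc n)
  have "kernel_op (k (real (Suc n) * t)) \<nu> A = kernel_op (k t) (kernel_op (k (real n * t)) \<nu>) A"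
    using kernel_op_add[of t "real n * t" \<nu> A] \<open>0 \<le> t\<close> \<nu> Suc.prems by (simp add: algebra_simps)
  also have "\<dots> = kernel_op (k t) ((kernel_op (k t) ^^ n) \<nu>) A"
    using Suc.IH by (subst kernel_op_cong) auto
  finally show ?case by simp
qed

lemma pos_var_antimono:
  assumes \<nu>: "signed_measure \<nu>" and "0 \<le> s" "s \<le> t"
  shows "pos_var (kernel_op (k t) \<nu>) UNIV \<le> pos_var (kernel_op (k s) \<nu>) UNIV"
proof -
  interpret markov_kernel "k (t - s)" using \<open>s \<le> t\<close> by (intro markov_kernel_at) simp
  have "pos_var (kernel_op (k t) \<nu>) = pos_var (kernel_op (k (t - s)) (kernel_op (k s) \<nu>))"
    using kernel_op_add[of "t - s" s \<nu>] assms by (intro pos_var_cong) simp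
  then show ?thesis
    using pos_var_kernel_op_le[OF signed_measure_semigroup[OF \<open>0 \<le> s\<close> \<nu>]] by simp
qed

end

locale regular_markov_semigroup = markov_semigroup k
  for k :: "real \<Rightarrow> 'a::topological_space \<Rightarrow> 'a set \<Rightarrow> real" +
  fixes \<mu> :: "'a set \<Rightarrow> real" and t0 :: real
  assumes prob_invariant: "prob_signed_measure \<mu>" and invariant: "invariant_measure k \<mu>"
    and t0_pos: "0 < t0" and regular: "regular_at k t0"
begin

sublocale regular_kernel "k t0"
  using markov_kernel_at[of t0] t0_pos regular
  by (simp add: regular_kernel_def regular_kernel_axioms_def regular_at_def)

lemmas prob_invariantD = prob_signed_measureD[OF prob_invariant]

lemma kernel_op_invariant: "0 \<le> t \<Longrightarrow> A \<in> sets borel \<Longrightarrow> kernel_op (k t) \<mu> A = \<mu> A"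
  using invariant by (simp add: invariant_measure_def)

lemma equivalent_kernel:
  assumes "t0 \<le> t"
  shows "equivalent_measures \<mu> (k t x)"
  unfolding equivalent_measures_def
proof
  fix A :: "'a set" assume A: "A \<in> sets borel"
  interpret shifted: markov_kernel "k (t - t0)" using assms by (intro markov_kernel_at) simp
  have "\<mu> A = 0 \<longleftrightarrow> kernel_op (k t0) \<mu> A = 0"
    using kernel_op_invariant A t0_pos by simp
  also have "\<dots> \<longleftrightarrow> k t0 x A = 0" by (rule kernel_op_eq_0_iff[OF prob_invariant A])
  also have "\<dots> \<longleftrightarrow> kernel_op (k t0) (k (t - t0) x) A = 0"
    by (rule kernel_op_eq_0_iff[OF shifted.prob A, symmetric])
  also have "kernel_op (k t0) (k (t - t0) x) A = k t x A"
    using chapman_kolmogorov[of t0 "t - t0" A x] assms t0_pos A by simp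
  finally show "\<mu> A = 0 \<longleftrightarrow> k t x A = 0" .
qed

lemma abs_continuous_kernel_op: "abs_continuous \<mu> (kernel_op (k t0) \<nu>)"
  using equivalent_kernel[of t0] kernel_op_eq_0
  by (auto simp: abs_continuous_def equivalent_measures_def)

lemma pos_var_tendsto_0:
  assumes \<nu>: "signed_measure \<nu>" and "\<nu> UNIV = 0"
  shows "((\<lambda>t. pos_var (kernel_op (k t) \<nu>) UNIV) \<longlongrightarrow> 0) at_top"
proof (rule tendstoI)
  fix \<epsilon> :: real assume "0 < \<epsilon>"
  let ?D = "\<lambda>t. pos_var (kernel_op (k t) \<nu>) UNIV"
  have "(\<lambda>n. pos_var ((kernel_op (k t0) ^^ n) (kernel_op (k t0) \<nu>)) UNIV) \<longlonglongrightarrow> 0"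
    using \<nu> \<open>\<nu> UNIV = 0\<close> t0_pos
    by (intro pos_var_funpow_tendsto_0[OF prob_invariantD(2)] signed_measure_kernel_op
        abs_continuous_kernel_op) (auto simp: kernel_op_UNIV stationary_def kernel_op_invariant)
  moreover have "pos_var ((kernel_op (k t0) ^^ n) (kernel_op (k t0) \<nu>))
      = pos_var (kernel_op (k (real (Suc n) * t0)) \<nu>)" for n
    using kernel_op_multiple[of t0 \<nu> _ "Suc n"] \<nu> t0_pos
    by (intro pos_var_cong) (simp add: funpow_swap1)
  ultimately have "(\<lambda>n. ?D (real (Suc n) * t0)) \<longlonglongrightarrow> 0" by simp
  then have "eventually (\<lambda>n. ?D (real (Suc n) * t0) < \<epsilon>) sequentially"
    using \<open>0 < \<epsilon>\<close> by (rule order_tendstoD(2))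
  then obtain n where n: "?D (real (Suc n) * t0) < \<epsilon>"
    by (auto simp: eventually_sequentially)
  have "dist (?D t) 0 < \<epsilon>" if "real (Suc n) * t0 \<le> t" for t
  proof -
    have "0 \<le> real (Suc n) * t0" using t0_pos by simp
    then have "?D t < \<epsilon>" "0 \<le> ?D t"
      using pos_var_antimono[OF \<nu> _ that] n pos_var_nonneg signed_measure_semigroup[of t, OF _ \<nu>] that
      by force+
    then show ?thesis by simp
  qed
  then show "eventually (\<lambda>t. dist (?D t) 0 < \<epsilon>) at_top"
    by (rule eventually_at_top_linorderI)
qed

lemma tv_norm_tendsto_0:
  assumes \<nu>: "signed_measure \<nu>" and "\<nu> UNIV = 0"
  shows "((\<lambda>t. tv_norm (kernel_op (k t) \<nu>)) \<longlongrightarrow> 0) at_top"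
proof (rule tendsto_sandwich[OF _ _ tendsto_const])
  show "((\<lambda>t. 2 * pos_var (kernel_op (k t) \<nu>) UNIV) \<longlongrightarrow> 0) at_top"
    by (intro tendsto_mult_right_zero pos_var_tendsto_0 assms)
  have "0 \<le> tv_norm (kernel_op (k t) \<nu>)"
    "tv_norm (kernel_op (k t) \<nu>) \<le> 2 * pos_var (kernel_op (k t) \<nu>) UNIV" if "0 \<le> t" for t
  proof -
    note signed = signed_measure_semigroup[OF that \<nu>]
    show "0 \<le> tv_norm (kernel_op (k t) \<nu>)" by (rule tv_norm_nonneg[OF signed])
    show "tv_norm (kernel_op (k t) \<nu>) \<le> 2 * pos_var (kernel_op (k t) \<nu>) UNIV"
      using tv_norm_le[OF signed] neg_var_eq[OF signed, of UNIV] \<open>\<nu> UNIV = 0\<close>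
        markov_kernel.kernel_op_UNIV[OF markov_kernel_at[OF that] \<nu>] by simp
  qed
  then show "\<forall>\<^sub>F t in at_top. 0 \<le> tv_norm (kernel_op (k t) \<nu>)"
    "\<forall>\<^sub>F t in at_top. tv_norm (kernel_op (k t) \<nu>) \<le> 2 * pos_var (kernel_op (k t) \<nu>) UNIV"
    by (auto intro: eventually_at_top_linorderI[of 0])
qed

lemma tendsto_invariant_measure:
  assumes \<nu>: "signed_measure \<nu>"
  shows "((\<lambda>t. tv_norm (\<lambda>A. kernel_op (k t) \<nu> A - \<nu> UNIV * \<mu> A)) \<longlongrightarrow> 0) at_top"
proof -
  let ?\<rho> = "\<lambda>A. 1 * \<nu> A + (- \<nu> UNIV) * \<mu> A"
  have "((\<lambda>t. tv_norm (kernel_op (k t) ?\<rho>)) \<longlongrightarrow> 0) at_top"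
    using signed_measure_lincomb[OF \<nu> prob_invariantD(1), of 1 "- \<nu> UNIV"] prob_invariantD(3)
    by (intro tv_norm_tendsto_0) auto
  moreover have "tv_norm (kernel_op (k t) ?\<rho>) = tv_norm (\<lambda>A. kernel_op (k t) \<nu> A - \<nu> UNIV * \<mu> A)"
    if "0 \<le> t" for t
    by (rule tv_norm_cong)
      (subst markov_kernel.kernel_op_lincomb[OF markov_kernel_at[OF that] \<nu> prob_invariantD(1)];
       simp add: kernel_op_invariant that)
  then have "\<forall>\<^sub>F t in at_top. tv_norm (kernel_op (k t) ?\<rho>)
      = tv_norm (\<lambda>A. kernel_op (k t) \<nu> A - \<nu> UNIV * \<mu> A)"
    by (auto intro: eventually_at_top_linorderI[of 0])
  ultimately show ?thesis by (rule Lim_transform_eventually)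
qed

lemma invariant_measure_unique:
  assumes prob': "prob_signed_measure \<mu>'" and invariant': "invariant_measure k \<mu>'"
    and A: "A \<in> sets borel"
  shows "\<mu>' A = \<mu> A"
proof -
  note \<mu>'_prob = prob_signed_measureD[OF prob']
  let ?diff = "\<lambda>A. \<mu>' A - \<mu> A"
  have "tv_norm (\<lambda>A. kernel_op (k t) \<mu>' A - \<mu>' UNIV * \<mu> A) = tv_norm ?diff" if "0 \<le> t" for t
    using invariant' that \<mu>'_prob(3) by (intro tv_norm_cong) (simp add: invariant_measure_def)
  then have "\<forall>\<^sub>F t in at_top. tv_norm (\<lambda>A. kernel_op (k t) \<mu>' A - \<mu>' UNIV * \<mu> A) = tv_norm ?diff"
    by (auto intro: eventually_at_top_linorderI[of 0])
  then have "((\<lambda>_::real. tv_norm ?diff) \<longlongrightarrow> 0) at_top"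
    by (rule Lim_transform_eventually[OF tendsto_invariant_measure[OF \<mu>'_prob(1)]])
  then have "tv_norm ?diff = 0" by (simp add: tendsto_const_iff)
  moreover have "signed_measure ?diff"
    using signed_measure_lincomb[OF \<mu>'_prob(1) prob_invariantD(1), of 1 "- 1"] by simp
  ultimately show ?thesis using abs_le_tv_norm[of ?diff A] A by simp
qed

end

theorem theorem4p4:
  fixes k :: "real \<Rightarrow> 'a::polish_space \<Rightarrow> 'a set \<Rightarrow> real"
    and \<mu> :: "'a set \<Rightarrow> real"
    and t0 :: real
  assumes "kernel_semigroup k"
    and "markovian k"
    and "stoch_continuous k"
    and "prob_signed_measure \<mu>"
    and "invariant_measure k \<mu>"
    and "t0 > 0"
    and "regular_at k t0"
  shows "(\<forall>\<nu>. signed_measure \<nu> \<longrightarrow>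
            ((\<lambda>t. tv_norm (\<lambda>A. kernel_op (k t) \<nu> A - \<nu> UNIV * \<mu> A)) \<longlongrightarrow> 0) at_top)
       \<and> (\<forall>\<mu>'. prob_signed_measure \<mu>' \<and> invariant_measure k \<mu>' \<longrightarrow>
            (\<forall>A \<in> sets borel. \<mu>' A = \<mu> A))
       \<and> (\<forall>t\<ge>t0. \<forall>x. equivalent_measures \<mu> (k t x))"
proof -
  interpret regular_markov_semigroup k \<mu> t0
    using assms by unfold_locales
  show ?thesis
    using tendsto_invariant_measure invariant_measure_unique equivalent_kernel by blast
qed

end
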